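(* For every multilinear polynomial $p(x)=\sum_{J\subseteq N}\alpha_J\prod_{j\in J}x_j$ with real coefficients $\alpha_J$, we have $p(x)\ge 0$ for all $x\in X'$ if and only if $p(x)\ge 0$ for every extreme point $x$ of $X'$.
   Context: $N=\{1,\dots,n\}$ and $X'=\{x\in\mathbb{R}^n:L_j\le x_j\le U_j\ \text{for all } j\in N\}$, where $L_j<U_j$ are real numbers for each $j\in N$. *)

theory Defs
  imports "HOL-Analysis.Analysis"
begin

(* The finite type 'n plays the role of the index set N. *)

definition multilinear_poly :: "('n::finite set \<Rightarrow> real) \<Rightarrow> real ^ 'n \<Rightarrow> real" where
  "multilinear_poly \<alpha> x = (\<Sum>J\<in>Pow UNIV. \<alpha> J * (\<Prod>j\<in>J. x $ j))"

definition box_set :: "real ^ 'n::finite \<Rightarrow> real ^ 'n \<Rightarrow> (real ^ 'n) set" where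
  "box_set L U = {x. \<forall>j. L $ j \<le> x $ j \<and> x $ j \<le> U $ j}"

end

theory Submission
  imports Defs
begin

text \<open>
  Along a line parallel to a coordinate axis a multilinear polynomial is an affine function, so its
  value at a point of the box is a convex combination of its values at the two points where that
  line meets the facets \<open>x $ j = L $ j\<close> and \<open>x $ j = U $ j\<close>
  (\<open>multilinear_poly_upd_convex\<close>).  Pushing one coordinate after another to an end of its
  interval therefore bounds the value below by a value at some vertex, and a point all
  of whose coordinates are interval ends is extreme (\<open>extreme_point_box_setI\<close>).
\<close>

definition vec_upd :: "real ^ 'n::finite \<Rightarrow> 'n \<Rightarrow> real \<Rightarrow> real ^ 'n" where
  "vec_upd x j t = (\<chi> i. if i = j then t else x $ i)"

lemma vec_upd_nth [simp]: "vec_upd x j t $ i = (if i = j then t else x $ i)"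
  by (simp add: vec_upd_def)

text \<open>
  Each variable occurs in a monomial at most once, so as a function of \<open>x $ j\<close> a monomial is
  either constant or a fixed multiple of \<open>x $ j\<close>; both kinds respect convex combinations.
\<close>

lemma monomial_upd_convex:
  fixes x :: "real ^ 'n::finite"
  shows "(\<Prod>i\<in>J. vec_upd x j ((1 - s) * a + s * b) $ i) =
         (1 - s) * (\<Prod>i\<in>J. vec_upd x j a $ i) + s * (\<Prod>i\<in>J. vec_upd x j b $ i)"
proof (cases "j \<in> J")
  case True
  have "(\<Prod>i\<in>J. vec_upd x j t $ i) = t * (\<Prod>i\<in>J - {j}. x $ i)" for t
    by (subst prod.remove[OF _ True]) (auto intro!: prod.cong)
  then show ?thesis
    by (simp add: algebra_simps)
next
  case False
  then have "(\<Prod>i\<in>J. vec_upd x j t $ i) = (\<Prod>i\<in>J. x $ i)" for t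
    by (intro prod.cong) auto
  then show ?thesis
    by (simp add: algebra_simps)
qed

lemma multilinear_poly_upd_convex:
  "multilinear_poly \<alpha> (vec_upd x j ((1 - s) * a + s * b)) =
   (1 - s) * multilinear_poly \<alpha> (vec_upd x j a) + s * multilinear_poly \<alpha> (vec_upd x j b)"
  unfolding multilinear_poly_def monomial_upd_convex
  unfolding sum_distrib_left sum.distrib[symmetric]
  by (intro sum.cong refl) (simp add: algebra_simps)

text \<open>
  An interval end is not strictly between two points of the interval, so a segment of the box
  passing through such a point in its relative interior would be constant in every coordinate.
\<close>

lemma extreme_point_box_setI:
  fixes L U x :: "real ^ 'n::finite"
  assumes x: "x \<in> box_set L U" and ends: "\<And>j. x $ j = L $ j \<or> x $ j = U $ j"
  shows "x extreme_point_of box_set L U"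
  unfolding extreme_point_of_def
proof (intro conjI ballI notI)
  fix a b assume a: "a \<in> box_set L U" and b: "b \<in> box_set L U" and "x \<in> open_segment a b"
  then obtain u where "a \<noteq> b" and u: "0 < u" "u < 1" and xu: "x = (1 - u) *\<^sub>R a + u *\<^sub>R b"
    by (auto simp: in_segment)
  have "a $ j = b $ j" for j
  proof -
    have xj: "x $ j = (1 - u) * a $ j + u * b $ j"
      by (simp add: xu)
    have bounds: "L $ j \<le> a $ j" "L $ j \<le> b $ j" "a $ j \<le> U $ j" "b $ j \<le> U $ j"
      using a b by (auto simp: box_set_def)
    \<comment> \<open>For an end \<open>e\<close> the terms \<open>(1 - u) * (a $ j - e)\<close> and \<open>u * (b $ j - e)\<close>
        have the same sign and sum to zero, so both vanish.\<close>
    from ends[of j] show ?thesis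
    proof
      assume "x $ j = L $ j"
      then have "(1 - u) * (a $ j - L $ j) + u * (b $ j - L $ j) = 0"
        using xj by (simp add: algebra_simps)
      moreover have "0 \<le> (1 - u) * (a $ j - L $ j)" "0 \<le> u * (b $ j - L $ j)"
        using u bounds by auto
      ultimately have "(1 - u) * (a $ j - L $ j) = 0" "u * (b $ j - L $ j) = 0"
        by linarith+
      then show ?thesis using u by simp
    next
      assume "x $ j = U $ j"
      then have "(1 - u) * (U $ j - a $ j) + u * (U $ j - b $ j) = 0"
        using xj by (simp add: algebra_simps)
      moreover have "0 \<le> (1 - u) * (U $ j - a $ j)" "0 \<le> u * (U $ j - b $ j)"
        using u bounds by auto
      ultimately have "(1 - u) * (U $ j - a $ j) = 0" "u * (U $ j - b $ j) = 0"
        by linarith+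
      then show ?thesis using u by simp
    qed
  qed
  with \<open>a \<noteq> b\<close> show False
    by (simp add: vec_eq_iff)
qed (rule x)

text \<open>
  The induction is on the number of coordinates strictly inside their intervals, which drops when
  one such coordinate is moved to either end.
\<close>

lemma multilinear_poly_nonneg_box:
  fixes L U x :: "real ^ 'n::finite"
  assumes vertices: "\<And>v. v extreme_point_of box_set L U \<Longrightarrow> multilinear_poly \<alpha> v \<ge> 0"
    and x: "x \<in> box_set L U"
  shows "multilinear_poly \<alpha> x \<ge> 0"
  using x
proof (induction "card {j. x $ j \<noteq> L $ j \<and> x $ j \<noteq> U $ j}" arbitrary: x rule: less_induct)
  case less
  let ?I = "\<lambda>x. {j. x $ j \<noteq> L $ j \<and> x $ j \<noteq> U $ j}"
  show ?case
  proof (cases "?I x = {}")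
    case True
    then show ?thesis
      using less.prems by (intro vertices extreme_point_box_setI) auto
  next
    case False
    then obtain j where j: "x $ j \<noteq> L $ j" "x $ j \<noteq> U $ j"
      by auto
    have le: "L $ j \<le> x $ j" "x $ j \<le> U $ j"
      using less.prems by (auto simp: box_set_def)
    have end_nonneg: "multilinear_poly \<alpha> (vec_upd x j t) \<ge> 0" if "t = L $ j \<or> t = U $ j" for t
    proof (rule less.hyps)
      show "card (?I (vec_upd x j t)) < card (?I x)"
        by (rule psubset_card_mono) (use j that in \<open>auto split: if_splits\<close>)
      show "vec_upd x j t \<in> box_set L U"
        using less.prems that order_trans[OF le] by (auto simp: box_set_def)
    qed
    define s where "s = (x $ j - L $ j) / (U $ j - L $ j)"
    have s: "0 \<le> s" "s \<le> 1"
      using le j by (auto simp: s_def divide_simps)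
    have "s * (U $ j - L $ j) = x $ j - L $ j"
      using le j by (simp add: s_def)
    then have "(1 - s) * L $ j + s * U $ j = x $ j"
      by (simp add: algebra_simps)
    then have "x = vec_upd x j ((1 - s) * L $ j + s * U $ j)"
      by (simp add: vec_eq_iff)
    then have "multilinear_poly \<alpha> x =
        (1 - s) * multilinear_poly \<alpha> (vec_upd x j (L $ j)) +
        s * multilinear_poly \<alpha> (vec_upd x j (U $ j))"
      by (metis multilinear_poly_upd_convex)
    also have "\<dots> \<ge> 0"
      using s end_nonneg by simp
    finally show ?thesis .
  qed
qed

theorem corollary4p2:
  fixes L U :: "real ^ 'n::finite"
    and \<alpha> :: "'n set \<Rightarrow> real"
  assumes "\<And>j. L $ j < U $ j"
  shows "(\<forall>x \<in> box_set L U. multilinear_poly \<alpha> x \<ge> 0) \<longleftrightarrow>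
         (\<forall>x. x extreme_point_of (box_set L U) \<longrightarrow> multilinear_poly \<alpha> x \<ge> 0)"
  using multilinear_poly_nonneg_box by (auto simp: extreme_point_of_def)

end
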